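(* Let $G=(V,E)$ be a finite simple undirected graph, let $C$ be its clique complex, let $d\ge 0$ be an integer, and suppose that the set $C_d$ of $d$-faces of $C$ is non-empty. Let $\mathrm{F}_d(C)=\frac{1}{|C_d|}\sum_{\alpha\in C_d}\mathrm{F}(\alpha)$ be the global $d$-th Forman-Ricci curvature of $C$ and, for $x\in V$, let $\mathrm{f}_d(x)=\frac{1}{(d+1)\,|C_d|}\sum_{\alpha\in C_d,\ x\in\alpha}\mathrm{F}(\alpha)$ be the local Forman-Ricci curvature at $x$. Then $$\mathrm{F}_d(C)=\sum_{x\in V}\mathrm{f}_d(x).$$
   Context: The clique complex $C=\bigcup_d C_d$ of $G$ is the set of all non-empty vertex sets of complete subgraphs of $G$. A $d$-face is such a vertex set with $d+1$ elements, and $C_d$ is the set of all $d$-faces. The boundary $\partial(\alpha)$ of a $d$-face $\alpha$ is the set of all $(d-1)$-faces contained in $\alpha$; write $\gamma<\alpha$ if $\gamma\in\partial(\alpha)$. Two distinct $d$-faces $\alpha_1,\alpha_2$ are considered with respect to two conditions: (1) there is a $(d-1)$-face $\gamma$ with $\gamma<\alpha_1$ and $\gamma<\alpha_2$; (2) there is a $(d+1)$-face $\beta$ with $\alpha_1<\beta$ and $\alpha_2<\beta$. They are parallel neighbours if (1) holds but (2) does not. For $\alpha\in C_d$, let $H_\alpha$ be the set of $(d+1)$-faces of $C$ containing $\alpha$ in their boundary and let $P_\alpha$ be the set of parallel neighbours of $\alpha$. The Forman-Ricci curvature of $\alpha$ is $$\mathrm{F}(\alpha)=|H_\alpha|+(d+1)-|P_\alpha|.$$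 *)

theory Defs
  imports Complex_Main "HOL-Library.Ramsey"
begin

text \<open>
  A finite simple undirected graph is given by a finite vertex set \<open>V\<close> and a set
  \<open>E \<subseteq> [V]\<^bsup>2\<^esup>\<close> of two-element subsets of \<open>V\<close>.
\<close>

definition clique_complex :: "'a set \<Rightarrow> 'a set set \<Rightarrow> 'a set set" where
  "clique_complex V E = {\<alpha>. \<alpha> \<noteq> {} \<and> \<alpha> \<subseteq> V \<and> clique \<alpha> E}"

definition faces :: "'a set \<Rightarrow> 'a set set \<Rightarrow> nat \<Rightarrow> 'a set set" where
  "faces V E d = {\<alpha> \<in> clique_complex V E. card \<alpha> = d + 1}"

text \<open>
  The boundary of a \<open>d\<close>-face. Its elements are the \<open>(d-1)\<close>-faces, stated as cliques with
  \<open>d\<close> vertices to avoid truncated subtraction. The clique complex does not contain the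
  empty set, so the boundary of a \<open>0\<close>-face is empty.
\<close>

definition boundary :: "'a set \<Rightarrow> 'a set set \<Rightarrow> nat \<Rightarrow> 'a set \<Rightarrow> 'a set set" where
  "boundary V E d \<alpha> = {\<gamma> \<in> clique_complex V E. card \<gamma> = d \<and> \<gamma> \<subseteq> \<alpha>}"

text \<open>
  In the definitions below \<open>d\<close> is the dimension of the faces \<open>\<alpha>\<close>, \<open>\<alpha>\<^sub>1\<close> and \<open>\<alpha>\<^sub>2\<close>.
\<close>

definition parallel_neighbours ::
    "'a set \<Rightarrow> 'a set set \<Rightarrow> nat \<Rightarrow> 'a set \<Rightarrow> 'a set \<Rightarrow> bool" where
  "parallel_neighbours V E d \<alpha>\<^sub>1 \<alpha>\<^sub>2 \<longleftrightarrow>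
     \<alpha>\<^sub>1 \<in> faces V E d \<and> \<alpha>\<^sub>2 \<in> faces V E d \<and> \<alpha>\<^sub>1 \<noteq> \<alpha>\<^sub>2 \<and>
     (\<exists>\<gamma>. \<gamma> \<in> boundary V E d \<alpha>\<^sub>1 \<and> \<gamma> \<in> boundary V E d \<alpha>\<^sub>2) \<and>
     \<not> (\<exists>\<beta> \<in> faces V E (d + 1).
          \<alpha>\<^sub>1 \<in> boundary V E (d + 1) \<beta> \<and> \<alpha>\<^sub>2 \<in> boundary V E (d + 1) \<beta>)"

definition cofaces :: "'a set \<Rightarrow> 'a set set \<Rightarrow> nat \<Rightarrow> 'a set \<Rightarrow> 'a set set" where
  "cofaces V E d \<alpha> = {\<beta> \<in> faces V E (d + 1). \<alpha> \<in> boundary V E (d + 1) \<beta>}"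

definition forman_ricci :: "'a set \<Rightarrow> 'a set set \<Rightarrow> nat \<Rightarrow> 'a set \<Rightarrow> real" where
  "forman_ricci V E d \<alpha> =
     real (card (cofaces V E d \<alpha>)) + (real d + 1)
       - real (card {\<alpha>'. parallel_neighbours V E d \<alpha> \<alpha>'})"

definition global_forman_ricci :: "'a set \<Rightarrow> 'a set set \<Rightarrow> nat \<Rightarrow> real" where
  "global_forman_ricci V E d =
     1 / real (card (faces V E d)) * (\<Sum>\<alpha> \<in> faces V E d. forman_ricci V E d \<alpha>)"

definition local_forman_ricci :: "'a set \<Rightarrow> 'a set set \<Rightarrow> nat \<Rightarrow> 'a \<Rightarrow> real" where
  "local_forman_ricci V E d x =
     1 / ((real d + 1) * real (card (faces V E d))) *
       (\<Sum>\<alpha> \<in> {\<alpha> \<in> faces V E d. x \<in> \<alpha>}. forman_ricci V E d \<alpha>)"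

end

theory Submission
  imports Defs
begin

text \<open>Double counting of the incident pairs (x, \<alpha>) with x a vertex of the d-face
  \<alpha>. Summed over x, the local curvatures count the curvature of each face once per vertex,
  that is d + 1 times, and the normalisation 1/(d + 1) cancels this multiplicity. The exchange of
  sums is \<open>sum_faces_containing\<close>, stated for an arbitrary weight \<open>g\<close> on
  faces.\<close>

lemma finite_faces: "finite V \<Longrightarrow> finite (faces V E d)"
  by (rule finite_subset[of _ "Pow V"]) (auto simp: faces_def clique_complex_def)

lemma sum_faces_containing:
  fixes g :: "'a set \<Rightarrow> real"
  assumes "finite V"
  shows "(\<Sum>x\<in>V. \<Sum>\<alpha> \<in> {\<alpha> \<in> faces V E d. x \<in> \<alpha>}. g \<alpha>) = (real d + 1) * (\<Sum>\<alpha> \<in> faces V E d. g \<alpha>)"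
proof -
  have "(\<Sum>x\<in>V. \<Sum>\<alpha> \<in> {\<alpha> \<in> faces V E d. x \<in> \<alpha>}. g \<alpha>) = (\<Sum>\<alpha> \<in> faces V E d. \<Sum>x \<in> {x \<in> V. x \<in> \<alpha>}. g \<alpha>)"
    by (rule sum.swap_restrict[OF assms finite_faces[OF assms]])
  also have "\<dots> = (\<Sum>\<alpha> \<in> faces V E d. (real d + 1) * g \<alpha>)"
  proof (rule sum.cong[OF refl])
    fix \<alpha> assume "\<alpha> \<in> faces V E d"
    \<comment> \<open>Faces lie inside \<open>V\<close>, so the inner sum runs over all d + 1
      vertices of \<alpha>, with a summand constant in x.\<close>
    then have "{x \<in> V. x \<in> \<alpha>} = \<alpha>" and "card \<alpha> = d + 1"
      by (auto simp: faces_def clique_complex_def)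
    then show "(\<Sum>x \<in> {x \<in> V. x \<in> \<alpha>}. g \<alpha>) = (real d + 1) * g \<alpha>"
      by simp
  qed
  finally show ?thesis
    by (simp add: sum_distrib_left)
qed

theorem theorem7p1:
  fixes V :: "'a set" and E :: "'a set set" and d :: nat
  assumes "finite V" and "E \<subseteq> [V]\<^bsup>2\<^esup>"
    and "faces V E d \<noteq> {}"
  shows "global_forman_ricci V E d = (\<Sum>x\<in>V. local_forman_ricci V E d x)"
proof -
  have "(\<Sum>x\<in>V. local_forman_ricci V E d x) =
      1 / ((real d + 1) * real (card (faces V E d))) *
        ((real d + 1) * (\<Sum>\<alpha> \<in> faces V E d. forman_ricci V E d \<alpha>))"
    \<comment> \<open>The normalising factor does not depend on x, so it leaves the sum before the
      double count applies.\<close>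
    unfolding local_forman_ricci_def sum_distrib_left[symmetric] sum_faces_containing[OF assms(1)] ..
  moreover have "real d + 1 \<noteq> 0"
    by linarith
  ultimately show ?thesis
    by (simp add: global_forman_ricci_def)
qed

end
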